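(* For every $n\ge 1$, $\mathfrak{S}^{\mathrm{BPD}}=\sum_{w\in S_n}\mathfrak{S}_w\, w$ in $\mathbb{Q}[x_1,\dots,x_{n-1}][S_n]$.
   Context: Permutations in one-line notation, $w_0=[n,\dots,1]$, $t_{i,j}$ the transposition of $i<j$, $wt_{i,j}$ is $w$ with positions $i,j$ swapped, $\ell$ the number of inversions, and $u\lessdot w$ means $w=ut_{i,j}$ with $\ell(w)=\ell(u)+1$. Schubert polynomials: $\mathfrak{S}_{w_0}=x_1^{n-1}x_2^{n-2}\cdots x_{n-1}$, and for $i\in[n-1]$ with $w(i)>w(i+1)$, $\mathfrak{S}_{wt_{i,i+1}}=\partial_i\mathfrak{S}_w$, where $\partial_i f=\frac{f-f(\dots,x_{i+1},x_i,\dots)}{x_i-x_{i+1}}$. The Fomin–Kirillov algebra $\mathcal{E}_n$ is generated by $d_{i,j}$ ($1\le i<j\le n$) with relations $d_{i,j}^2=0$; $d_{i,j}d_{j,k}=d_{i,k}d_{i,j}+d_{j,k}d_{i,k}$ and $d_{j,k}d_{i,j}=d_{i,j}d_{i,k}+d_{i,k}d_{j,k}$ for $i<j<k$; $d_{i,j}d_{k,l}=d_{k,l}d_{i,j}$ for $i,j,k,l$ distinct. It acts on the right on $\mathbb{Q}[S_n]$ by $w\odot d_{i,j}=wt_{i,j}$ if $wt_{i,j}\lessdot w$ and $0$ otherwise (so $w\odot(e_1e_2)=(w\odot e_1)\odot e_2$). The algebra $\mathbb{Q}[x_1,\dots,x_{n-1}]\otimes\mathcal{E}_n$ acts on the right on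 $\mathbb{Q}[x_1,\dots,x_{n-1}][S_n]$ by $(fw)\odot(g\otimes e)=fg\,(w\odot e)$. For $i<j$ let $B_{i,j}=d_{1,j}+d_{2,j}+\dots+d_{i,j}$, and for $i\in[n-1]$ let $R_i(x_i)=(x_i+B_{i,i+1})(x_i+B_{i,i+2})\cdots(x_i+B_{i,n})$. Define $\mathfrak{S}^{\mathrm{BPD}}=w_0\odot\big(R_1(x_1)R_2(x_2)\cdots R_{n-1}(x_{n-1})\big)$. *)

theory Defs
  imports "HOL-Library.Poly_Mapping" "HOL-Combinatorics.Combinatorics"
begin

(* Multivariate polynomials over Q: variables indexed by nat (x_1, x_2, ...),
   monomials are exponent maps nat =>0 nat. *)
type_synonym mpoly = "(nat \<Rightarrow>\<^sub>0 nat) \<Rightarrow>\<^sub>0 rat"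

definition X :: "nat \<Rightarrow> mpoly" where
  "X i = Poly_Mapping.single (Poly_Mapping.single i 1) 1"

definition swap_mon :: "nat \<Rightarrow> (nat \<Rightarrow>\<^sub>0 nat) \<Rightarrow> (nat \<Rightarrow>\<^sub>0 nat)" where
  "swap_mon i m = Poly_Mapping.map_key (Transposition.transpose i (Suc i)) m"

definition swap_poly :: "nat \<Rightarrow> mpoly \<Rightarrow> mpoly" where
  "swap_poly i f = Poly_Mapping.map_key (swap_mon i) f"

definition divdiff :: "nat \<Rightarrow> mpoly \<Rightarrow> mpoly" where
  "divdiff i f = (THE g. (X i - X (Suc i)) * g = f - swap_poly i f)"

(* permutations of [n] in one-line notation: functions nat => nat permuting {1..n} *)
definition w0 :: "nat \<Rightarrow> nat \<Rightarrow> nat" where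
  "w0 n = (\<lambda>k. if 1 \<le> k \<and> k \<le> n then n + 1 - k else k)"

definition inv_num :: "nat \<Rightarrow> (nat \<Rightarrow> nat) \<Rightarrow> nat" where
  "inv_num n w = card {(i, j). 1 \<le> i \<and> i < j \<and> j \<le> n \<and> w j < w i}"

definition tmul :: "(nat \<Rightarrow> nat) \<Rightarrow> nat \<Rightarrow> nat \<Rightarrow> (nat \<Rightarrow> nat)" where
  "tmul w i j = w \<circ> Transposition.transpose i j"

(* elements of Q[x][S_n]: functions from permutations to coefficients (support in S_n) *)
type_synonym galg = "(nat \<Rightarrow> nat) \<Rightarrow> mpoly"

definition basis :: "(nat \<Rightarrow> nat) \<Rightarrow> galg" where
  "basis w = (\<lambda>v. if v = w then 1 else 0)"

(* right action of d_{i,j} (extended linearly):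
   u \<odot> d_{i,j} = u t_{i,j} if u t_{i,j} \<lessdot> u, else 0.
   Coefficient of v in V \<odot> d_{i,j} is V(v t_{i,j}) if v \<lessdot> v t_{i,j}. *)
definition act_d :: "nat \<Rightarrow> nat \<Rightarrow> nat \<Rightarrow> galg \<Rightarrow> galg" where
  "act_d n i j V = (\<lambda>v. if v permutes {1..n} \<and> inv_num n (tmul v i j) = inv_num n v + 1
                          then V (tmul v i j) else 0)"

definition act_factor :: "nat \<Rightarrow> nat \<Rightarrow> nat \<Rightarrow> galg \<Rightarrow> galg" where
  "act_factor n i j V = (\<lambda>v. X i * V v + (\<Sum>k = 1..i. act_d n k j V v))"

(* right action of R_i(x_i) = (x_i + B_{i,i+1}) ... (x_i + B_{i,n});
   leftmost factor acts first *)
definition act_R :: "nat \<Rightarrow> nat \<Rightarrow> galg \<Rightarrow> galg" where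
  "act_R n i V = fold (act_factor n i) [Suc i..<Suc n] V"

definition S_BPD :: "nat \<Rightarrow> galg" where
  "S_BPD n = fold (act_R n) [1..<n] (basis (w0 n))"

end

theory Submission
  imports Defs
begin

text \<open>
  Write \<open>d\<^sub>p\<^sub>q\<close> for the generators and put
  \<open>y\<^sub>j = (\<Sum>p<j. d\<^sub>p\<^sub>j) - (\<Sum>q>j. d\<^sub>j\<^sub>q)\<close>, the negated Dunkl elements. Let \<open>u\<^sub>i\<close> be the
  operator sending \<open>w\<close> to \<open>w t\<^sub>i\<^sub>,\<^sub>i\<^sub>+\<^sub>1\<close> if that is longer and to \<open>0\<close> otherwise. The \<open>u\<^sub>i\<close> and
  \<open>y\<^sub>j\<close> satisfy nil-Hecke relations, from which the \<open>y\<^sub>j\<close> commute.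

  On the span of permutations that are decreasing in positions \<open>> m\<close>, the row operator
  \<open>R\<^sub>m(x)\<close> coincides with the symmetric product \<open>\<Prod>j>m. (x + y\<^sub>j)\<close>; the supports
  arising in \<open>w\<^sub>0 \<odot> R\<^sub>1 \<cdots> R\<^sub>m\<^sub>-\<^sub>1\<close> are of this kind. Hence
  \<open>V = w\<^sub>0 \<odot> (\<Prod>i<j. (x\<^sub>i + y\<^sub>j))\<close>. The factors other than \<open>x\<^sub>i + y\<^sub>i\<^sub>+\<^sub>1\<close> form
  an element \<open>G\<close> that is symmetric in \<open>x\<^sub>i, x\<^sub>i\<^sub>+\<^sub>1\<close> and killed by \<open>u\<^sub>i\<close>, so
  \<open>\<partial>\<^sub>i V = G = V u\<^sub>i\<close>, which is the recursion that defines Schubert polynomials.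
\<close>

declare One_nat_def [simp del]

section \<open>Bruhat covers and the action of the Fomin--Kirillov generators\<close>

text \<open>The pattern form of the Bruhat cover from \<open>v\<close> up to
  \<open>tmul v p q\<close>; unlike the difference of inversion numbers it can be checked position
  by position.\<close>

definition cov :: "(nat \<Rightarrow> nat) \<Rightarrow> nat \<Rightarrow> nat \<Rightarrow> bool" where
  "cov v p q \<longleftrightarrow> v p < v q \<and> (\<forall>r. p < r \<and> r < q \<longrightarrow> v r < v p \<or> v q < v r)"

lemma tmul_apply: "tmul v i j k = v (Transposition.transpose i j k)"
  by (simp add: tmul_def)

lemma tmul_tmul [simp]: "tmul (tmul v i j) i j = v"
  by (simp add: tmul_def comp_assoc)

lemma permutes_tmul:
  assumes "v permutes {1..n}" "1 \<le> i" "i \<le> n" "1 \<le> j" "j \<le> n"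
  shows "tmul v i j permutes {1..n}"
  unfolding tmul_def using assms by (intro permutes_compose permutes_swap_id) auto

lemma permutes_eq_iff:
  assumes "v permutes {1..n}"
  shows "v a = v b \<longleftrightarrow> a = b"
  using permutes_inj[OF assms] by (auto dest: injD)

section \<open>Inversion numbers under transpositions\<close>

definition invs :: "nat \<Rightarrow> (nat \<Rightarrow> nat) \<Rightarrow> (nat \<times> nat) set" where
  "invs n v = {(i, j). 1 \<le> i \<and> i < j \<and> j \<le> n \<and> v j < v i}"

lemma inv_num_eq_card_invs: "inv_num n v = card (invs n v)"
  by (simp only: inv_num_def invs_def)

text \<open>Exchanging i and i + 1 in both entries of a pair carries the inversions of
  \<open>v\<close> bijectively onto those of the swapped permutation other than the new inversion
  (i, i + 1).\<close>

lemma inv_num_adjacent: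
  assumes "1 \<le> i" "i < n" "v i < v (Suc i)"
  shows "inv_num n (tmul v i (Suc i)) = inv_num n v + 1"
proof -
  let ?t = "Transposition.transpose i (Suc i)"
  have "finite (invs n v)"
    by (rule finite_subset[of _ "{1..n} \<times> {1..n}"]) (auto simp: invs_def)
  moreover have "invs n (tmul v i (Suc i)) = insert (i, Suc i) (map_prod ?t ?t ` invs n v)"
    (is "?L = ?R")
  proof (rule set_eqI)
    fix x :: "nat \<times> nat"
    obtain a b where x: "x = (a, b)" by force
    have "x \<in> map_prod ?t ?t ` invs n v \<longleftrightarrow> (?t a, ?t b) \<in> invs n v"
      unfolding x by (force simp: image_iff)
    moreover have "x \<in> ?L \<longleftrightarrow> x = (i, Suc i) \<or> (?t a, ?t b) \<in> invs n v"
      using assms by (auto simp: x invs_def tmul_def Transposition.transpose_def split: if_splits)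
    ultimately show "x \<in> ?L \<longleftrightarrow> x \<in> ?R" by auto
  qed
  moreover have "(i, Suc i) \<notin> map_prod ?t ?t ` invs n v"
    by (auto simp: invs_def Transposition.transpose_def split: if_splits)
  moreover have "inj_on (map_prod ?t ?t) (invs n v)"
    by (intro inj_on_subset[OF map_prod_inj_on[of _ UNIV _ UNIV]]) (auto intro: inj_onI)
  ultimately show ?thesis
    by (simp add: inv_num_eq_card_invs card_image)
qed

lemma inv_num_adjacent_descent:
  assumes "1 \<le> i" "i < n" "v (Suc i) < v i"
  shows "inv_num n v = inv_num n (tmul v i (Suc i)) + 1"
  using inv_num_adjacent[of i n "tmul v i (Suc i)"] assms by (simp add: tmul_apply)

text \<open>Induction on q - p through t_pq = s_p t_{p+1,q} s_p, where s_p = t_{p,p+1}. The two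
  outer swaps both add an inversion if the value at p + 1 lies between those at p and q; otherwise
  their effects cancel. So \<open>k\<close> counts the positions that violate
  \<open>cov\<close>.\<close>

lemma inv_num_tmul_ascent:
  assumes "v permutes {1..n}" "1 \<le> p" "p < q" "q \<le> n" "v p < v q"
  shows "\<exists>k. inv_num n (tmul v p q) = inv_num n v + 1 + 2 * k \<and> (k = 0 \<longleftrightarrow> cov v p q)"
  using assms
proof (induction "q - p" arbitrary: p v)
  case 0
  then show ?case by simp
next
  case (Suc d)
  show ?case
  proof (cases "q = Suc p")
    case True
    then show ?thesis
      using inv_num_adjacent[of p n v] Suc.prems by (intro exI[of _ 0]) (auto simp: cov_def)
  next
    case False
    then have q: "Suc p < q" using Suc.prems by simp
    define v' where "v' = tmul v p (Suc p)"
    define v'' where "v'' = tmul v' (Suc p) q"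
    have v': "v' permutes {1..n}" unfolding v'_def
      using Suc.prems q by (intro permutes_tmul) auto
    have val: "v' p = v (Suc p)" "v' (Suc p) = v p" "v' q = v q"
      "\<And>r. Suc p < r \<Longrightarrow> v' r = v r" "v'' p = v (Suc p)" "v'' (Suc p) = v q"
      using q by (auto simp: v'_def v''_def tmul_apply Transposition.transpose_def)
    have eq: "tmul v p q = tmul v'' p (Suc p)"
      using q by (auto simp: v'_def v''_def tmul_def fun_eq_iff Transposition.transpose_def)
    have d: "d = q - Suc p" using Suc.hyps(2) by simp
    obtain k where k: "inv_num n v'' = inv_num n v' + 1 + 2 * k" "k = 0 \<longleftrightarrow> cov v' (Suc p) q"
      using Suc.hyps(1)[of "Suc p" v'] d v' Suc.prems q val(2,3) unfolding v''_def by auto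
    have "(p < r \<and> r < q) \<longleftrightarrow> r = Suc p \<or> (Suc p < r \<and> r < q)" for r
      using q by linarith
    then have covv: "cov v p q \<longleftrightarrow> cov v' (Suc p) q \<and> (v (Suc p) < v p \<or> v q < v (Suc p))"
      unfolding cov_def using val(2-4) Suc.prems(5) by auto
    have ne: "v (Suc p) \<noteq> v p" "v (Suc p) \<noteq> v q"
      using permutes_eq_iff[OF Suc.prems(1)] q by auto
    have s1: "v p < v (Suc p) \<Longrightarrow> inv_num n v' = inv_num n v + 1"
      "v (Suc p) < v p \<Longrightarrow> inv_num n v = inv_num n v' + 1"
      unfolding v'_def using inv_num_adjacent[of p n v] inv_num_adjacent_descent[of p n v]
        Suc.prems q by auto
    have s2: "v (Suc p) < v q \<Longrightarrow> inv_num n (tmul v p q) = inv_num n v'' + 1"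
      "v q < v (Suc p) \<Longrightarrow> inv_num n v'' = inv_num n (tmul v p q) + 1"
      unfolding eq using inv_num_adjacent[of p n v''] inv_num_adjacent_descent[of p n v'']
        Suc.prems q val by auto
    consider "v p < v (Suc p)" "v (Suc p) < v q" | "v (Suc p) < v p" | "v q < v (Suc p)"
      using ne by linarith
    then show ?thesis
    proof cases
      case 1
      then have "\<not> cov v p q" using covv by linarith
      then show ?thesis using 1 s1(1) s2(1) k(1) by (intro exI[of _ "Suc k"]) simp
    next
      case 2
      then show ?thesis using s1 s2 k covv Suc.prems by (intro exI[of _ k]) auto
    next
      case 3
      then show ?thesis using s1 s2 k covv Suc.prems by (intro exI[of _ k]) auto
    qed
  qed
qed

lemma inv_num_tmul_cover_iff:
  assumes "v permutes {1..n}" "1 \<le> p" "p < q" "q \<le> n"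
  shows "inv_num n (tmul v p q) = inv_num n v + 1 \<longleftrightarrow> cov v p q"
proof (cases "v p < v q")
  case True
  then show ?thesis using inv_num_tmul_ascent[OF assms] by auto
next
  case False
  then have "v q < v p" using permutes_eq_iff[OF assms(1), of p q] assms by auto
  then have "\<exists>k. inv_num n v = inv_num n (tmul v p q) + 1 + 2 * k"
    using inv_num_tmul_ascent[of "tmul v p q" n p q] permutes_tmul[of v n p q] assms
    by (auto simp: tmul_apply)
  then show ?thesis using False by (auto simp: cov_def)
qed

lemma act_d_eq:
  assumes "1 \<le> p" "p < q" "q \<le> n"
  shows "act_d n p q V v = (if v permutes {1..n} \<and> cov v p q then V (tmul v p q) else 0)"
  using assms inv_num_tmul_cover_iff[of v n p q] by (auto simp: act_d_def)

text \<open>One swap affects the cover condition of the other only at the positions it moves. If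
  both of them lie between the other two, their values are merely exchanged. If only one does, the
  intervals interleave, and the condition on p, q at the end point inside its interval rules out the
  obstruction.\<close>

lemma cov_tmul_disjoint:
  assumes v: "v permutes {1..n}" and "p < q" "r < s" "{p, q} \<inter> {r, s} = {}"
    and cpq: "cov v p q" and crs: "cov (tmul v p q) r s"
  shows "cov v r s \<and> cov (tmul v r s) p q"
proof -
  have rs: "tmul v p q r = v r" "tmul v p q s = v s" "tmul v p q p = v q" "tmul v p q q = v p"
    "\<And>x. x \<noteq> p \<Longrightarrow> x \<noteq> q \<Longrightarrow> tmul v p q x = v x"
    using assms(2-4) by (auto simp: tmul_apply Transposition.transpose_def)
  have pq: "tmul v r s p = v p" "tmul v r s q = v q" "tmul v r s r = v s" "tmul v r s s = v r"
    "\<And>x. x \<noteq> r \<Longrightarrow> x \<noteq> s \<Longrightarrow> tmul v r s x = v x"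
    using assms(2-4) by (auto simp: tmul_apply Transposition.transpose_def)
  have lt: "v p < v q" "v r < v s" using cpq crs rs by (auto simp: cov_def)
  have P: "\<And>x. p < x \<Longrightarrow> x < q \<Longrightarrow> v x < v p \<or> v q < v x" using cpq by (auto simp: cov_def)
  have R: "\<And>x. r < x \<Longrightarrow> x < s \<Longrightarrow> tmul v p q x < v r \<or> v s < tmul v p q x"
    using crs rs(1,2) by (simp add: cov_def)
  have ne: "q < s \<or> s < q" "p < r \<or> r < p" using assms(4) by auto
  have "v x < v r \<or> v s < v x" if x: "r < x" "x < s" for x
  proof -
    consider "x = p" "q < s" | "x = p" "s < q" | "x = q" "p < r" | "x = q" "r < p" | "x \<noteq> p" "x \<noteq> q"
      using ne by blast
    then show ?thesis
    proof cases
      case 1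
      then show ?thesis using R[of q] rs(4) x \<open>p < q\<close> by simp
    next
      case 2
      then show ?thesis using R[of p] rs(3) P[of s] lt x by auto
    next
      case 3
      then show ?thesis using R[of q] rs(4) P[of r] lt x by auto
    next
      case 4
      then show ?thesis using R[of p] rs(3) x \<open>p < q\<close> by simp
    next
      case 5
      then show ?thesis using R[of x] rs(5) x by simp
    qed
  qed
  moreover have "tmul v r s x < v p \<or> v q < tmul v r s x" if x: "p < x" "x < q" for x
  proof -
    consider "x = r" "q < s" | "x = r" "s < q" | "x = s" "p < r" | "x = s" "r < p" | "x \<noteq> r" "x \<noteq> s"
      using ne by blast
    then show ?thesis
    proof cases
      case 1
      then show ?thesis using R[of q] rs(4) P[of r] pq(3) lt x by auto
    next
      case 2
      then show ?thesis using P[of s] pq(3) x \<open>r < s\<close> by simp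
    next
      case 3
      then show ?thesis using P[of r] pq(4) x \<open>r < s\<close> by simp
    next
      case 4
      then show ?thesis using R[of p] rs(3) P[of s] pq(4) lt x by auto
    next
      case 5
      then show ?thesis using P[of x] pq(5) x by simp
    qed
  qed
  ultimately show ?thesis using lt pq(1,2) by (simp add: cov_def)
qed

lemma act_d_commute:
  assumes "1 \<le> p" "p < q" "q \<le> n" "1 \<le> r" "r < s" "s \<le> n" and disj: "{p, q} \<inter> {r, s} = {}"
  shows "act_d n p q (act_d n r s V) = act_d n r s (act_d n p q V)"
proof
  fix v
  have "cov v p q \<and> cov (tmul v p q) r s \<longleftrightarrow> cov v r s \<and> cov (tmul v r s) p q"
    if v: "v permutes {1..n}"
    using cov_tmul_disjoint[OF v, of p q r s] cov_tmul_disjoint[OF v, of r s p q] assms by blast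
  moreover have "tmul (tmul v p q) r s = tmul (tmul v r s) p q"
  proof
    fix x
    consider "x = p" | "x = q" | "x = r" | "x = s" | "x \<notin> {p, q, r, s}" by blast
    then show "tmul (tmul v p q) r s x = tmul (tmul v r s) p q x"
      using disj by cases (auto simp: tmul_apply)
  qed
  ultimately show "act_d n p q (act_d n r s V) v = act_d n r s (act_d n p q V) v"
    using assms by (auto simp: act_d_eq permutes_tmul)
qed

text \<open>This is the relation d_mq d_pm = d_pm d_pq + d_pq d_mq. All three products read the same
  coefficient of \<open>V\<close> and share the condition \<open>Q\<close> at positions other than
  m. They differ only in the relative order of the values at p, m, q, and the orders allowed on the
  left split into those of the two summands.\<close>

lemma act_d_triple:
  assumes "1 \<le> p" "p < m" "m < q" "q \<le> n"
  shows "act_d n p m (act_d n m q V) v =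
    act_d n p q (act_d n p m V) v + act_d n m q (act_d n p q V) v"
proof (cases "v permutes {1..n}")
  case False
  then show ?thesis using assms by (simp add: act_d_eq)
next
  case v: True
  have t: "tmul (tmul v p m) m q = tmul (tmul v m q) p q"
    "tmul (tmul v p q) p m = tmul (tmul v m q) p q"
  proof (rule_tac [!] ext)
    fix x
    consider "x = p" | "x = m" | "x = q" | "x \<notin> {p, q, m}" by blast
    then show "tmul (tmul v p m) m q x = tmul (tmul v m q) p q x"
      "tmul (tmul v p q) p m x = tmul (tmul v m q) p q x"
      using assms by (cases; simp add: tmul_apply Transposition.transpose_def)+
  qed
  have ne: "v p \<noteq> v m" "v p \<noteq> v q" "v m \<noteq> v q"
    using permutes_eq_iff[OF v] assms by auto
  define Q where "Q \<longleftrightarrow> (\<forall>x. p < x \<and> x < m \<longrightarrow> v x < v p \<or> v m < v x) \<and>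
    (\<forall>x. m < x \<and> x < q \<longrightarrow> v x < v p \<or> v q < v x)"
  have "p < x \<and> x < q \<longleftrightarrow> (p < x \<and> x < m) \<or> x = m \<or> (m < x \<and> x < q)" for x
    using assms by linarith
  then have sp: "(\<forall>x. p < x \<and> x < q \<longrightarrow> R x) \<longleftrightarrow>
      (\<forall>x. p < x \<and> x < m \<longrightarrow> R x) \<and> R m \<and> (\<forall>x. m < x \<and> x < q \<longrightarrow> R x)" for R
    by blast
  have val: "tmul v p m m = v p" "tmul v p m q = v q" "tmul v p q p = v q" "tmul v p q m = v m"
    "tmul v m q p = v p" "tmul v m q q = v m" "tmul v m q m = v q"
    "\<And>x. m < x \<Longrightarrow> tmul v p m x = v x" "\<And>x. p < x \<Longrightarrow> x < m \<Longrightarrow> tmul v p q x = v x"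
    "\<And>x. x < m \<Longrightarrow> tmul v m q x = v x" "\<And>x. m < x \<Longrightarrow> x < q \<Longrightarrow> tmul v m q x = v x"
    using assms by (simp_all add: tmul_apply Transposition.transpose_def)
  have c1: "cov v p m \<and> cov (tmul v p m) m q \<longleftrightarrow> v p < v m \<and> v p < v q \<and> Q"
    unfolding cov_def Q_def by (auto simp: val)
  have c2: "cov v p q \<and> cov (tmul v p q) p m \<longleftrightarrow> v p < v q \<and> v q < v m \<and> Q"
  proof -
    have "v p < v q \<Longrightarrow> v q < v m \<Longrightarrow> (v x < v p \<or> v q < v x) \<and> (v x < v q \<or> v m < v x) \<longleftrightarrow>
        v x < v p \<or> v m < v x" for x by auto
    then show ?thesis unfolding cov_def Q_def sp by (auto simp: val)
  qed
  have c3: "cov v m q \<and> cov (tmul v m q) p q \<longleftrightarrow> v p < v m \<and> v m < v q \<and> Q"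
  proof -
    have "v p < v m \<Longrightarrow> v m < v q \<Longrightarrow> (v x < v m \<or> v q < v x) \<and> (v x < v p \<or> v m < v x) \<longleftrightarrow>
        v x < v p \<or> v q < v x" for x by auto
    then show ?thesis using assms unfolding cov_def Q_def sp by (auto simp: val)
  qed
  have "act_d n p m (act_d n m q V) v =
      (if cov v p m \<and> cov (tmul v p m) m q then V (tmul (tmul v m q) p q) else 0)"
    "act_d n p q (act_d n p m V) v =
      (if cov v p q \<and> cov (tmul v p q) p m then V (tmul (tmul v m q) p q) else 0)"
    "act_d n m q (act_d n p q V) v =
      (if cov v m q \<and> cov (tmul v m q) p q then V (tmul (tmul v m q) p q) else 0)"
    using assms v t by (simp_all add: act_d_eq permutes_tmul)
  then show ?thesis unfolding c1 c2 c3 using ne by (cases Q) auto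
qed

section \<open>Exchanging two variables\<close>

lemma swap_mon_involutory: "swap_mon i (swap_mon i m) = m"
  by (simp add: swap_mon_def Poly_Mapping.map_key_compose Poly_Mapping.map_key_id[unfolded id_def[symmetric]])

lemma inj_swap_mon: "inj (swap_mon i)"
  by (metis injI swap_mon_involutory)

lemma swap_mon_add: "swap_mon i (a + b) = swap_mon i a + swap_mon i b"
  by (simp add: swap_mon_def Poly_Mapping.map_key_plus)

lemma swap_mon_single: "swap_mon i (Poly_Mapping.single k c) = Poly_Mapping.single (Transposition.transpose i (Suc i) k) c"
  using Poly_Mapping.map_key_single[of "Transposition.transpose i (Suc i)" "Transposition.transpose i (Suc i) k" c]
  by (simp add: swap_mon_def)

lemma swap_poly_add: "swap_poly i (f + g) = swap_poly i f + swap_poly i g"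
  by (simp add: swap_poly_def Poly_Mapping.map_key_plus inj_swap_mon)

lemma swap_poly_0: "swap_poly i 0 = 0"
  by (simp add: swap_poly_def inj_swap_mon)

lemma swap_poly_uminus: "swap_poly i (- f) = - swap_poly i f"
  using swap_poly_add[of i f "- f"] by (simp add: swap_poly_0 eq_neg_iff_add_eq_0 add.commute)

lemma swap_poly_sum: "swap_poly i (\<Sum>a\<in>A. f a) = (\<Sum>a\<in>A. swap_poly i (f a))"
  by (induction A rule: infinite_finite_induct) (simp_all add: swap_poly_0 swap_poly_add)

lemma swap_poly_single: "swap_poly i (Poly_Mapping.single m c) = Poly_Mapping.single (swap_mon i m) c"
  using Poly_Mapping.map_key_single[OF inj_swap_mon, of i "swap_mon i m" c]
  by (simp add: swap_poly_def swap_mon_involutory)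

lemma swap_poly_X: "swap_poly i (X k) = X (Transposition.transpose i (Suc i) k)"
  by (simp add: X_def swap_poly_single swap_mon_single)

lemma update_eq_single_add:
  "a \<notin> Poly_Mapping.keys f \<Longrightarrow> Poly_Mapping.update a b f = Poly_Mapping.single a b + f"
  by (rule poly_mapping_eqI) (auto simp: lookup_update lookup_add lookup_single in_keys_iff when_def)

text \<open>Peeling off one monomial at a time from either factor reduces multiplicativity to
  additivity of \<open>swap_mon\<close> on exponents.\<close>

lemma swap_poly_mult: "swap_poly i (f * g) = swap_poly i f * swap_poly i g"
proof (induction f rule: Poly_Mapping.update_induct)
  case const
  then show ?case by (simp add: swap_poly_0)
next
  case (update f a b)
  have "swap_poly i (Poly_Mapping.single a b * g) = Poly_Mapping.single (swap_mon i a) b * swap_poly i g"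
  proof (induction g rule: Poly_Mapping.update_induct)
    case const
    then show ?case by (simp add: swap_poly_0)
  next
    case (update g c d)
    then show ?case
      by (simp add: update_eq_single_add distrib_left swap_poly_add mult_single swap_poly_single swap_mon_add)
  qed
  with update show ?case
    by (simp add: update_eq_single_add distrib_right swap_poly_add swap_poly_single)
qed

lemma swap_poly_1: "swap_poly i 1 = 1"
  using swap_poly_single[of i 0 1] by (simp add: swap_mon_def)

lemma X_eq_iff: "X i = X j \<longleftrightarrow> i = j"
proof
  assume "X i = X j"
  then have "Poly_Mapping.lookup (X i) (Poly_Mapping.single i 1) = Poly_Mapping.lookup (X j) (Poly_Mapping.single i 1)"
    by simp
  then have "Poly_Mapping.single j 1 = (Poly_Mapping.single i 1 :: nat \<Rightarrow>\<^sub>0 nat)"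
    by (simp add: X_def lookup_single when_def split: if_splits)
  then have "Poly_Mapping.lookup (Poly_Mapping.single j (1::nat)) i = Poly_Mapping.lookup (Poly_Mapping.single i 1) i"
    by simp
  then show "i = j" by (simp add: lookup_single when_def split: if_splits)
qed simp

text \<open>Polynomials have no zero divisors, so the quotient is unique, and exhibiting one
  determines \<open>divdiff\<close>.\<close>

lemma divdiff_eqI:
  assumes "(X i - X (Suc i)) * g = f - swap_poly i f"
  shows "divdiff i f = g"
proof -
  have "X i - X (Suc i) \<noteq> 0" by (simp add: X_eq_iff)
  then show ?thesis unfolding divdiff_def
    using assms by (intro the_equality) (metis mult_left_cancel)+
qed

section \<open>Dunkl elements\<close>

text \<open>The \<open>v\<close>-coefficient of \<open>V u\<^sub>i\<close> comes from the shorter \<open>v t\<^sub>i\<^sub>,\<^sub>i\<^sub>+\<^sub>1\<close>, hence the descent condition on \<open>v\<close>.\<close>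

definition act_u :: "nat \<Rightarrow> nat \<Rightarrow> galg \<Rightarrow> galg" where
  "act_u n i V = (\<lambda>v. if v permutes {1..n} \<and> v (Suc i) < v i then V (tmul v i (Suc i)) else 0)"

lemma cov_adjacent: "cov v i (Suc i) \<longleftrightarrow> v i < v (Suc i)"
  by (auto simp: cov_def)

text \<open>Once matched by \<open>s\<close>, the open intervals (p, q) and (s p, s q) differ only
  if one of i, i + 1 is an end, and then only in the other one. The cover condition at that position
  accounts for the difference of the two descent conditions.\<close>

lemma cov_tmul_adjacent:
  fixes i :: nat
  defines "s \<equiv> Transposition.transpose i (Suc i)"
  assumes v: "v permutes {1..n}" and pq: "p < q" "(p, q) \<noteq> (i, Suc i)"
  shows "v (Suc i) < v i \<and> cov (tmul v i (Suc i)) (s p) (s q) \<longleftrightarrow>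
    cov v p q \<and> tmul v p q (Suc i) < tmul v p q i"
proof -
  have s: "s i = Suc i" "s (Suc i) = i" "\<And>x. x \<noteq> i \<Longrightarrow> x \<noteq> Suc i \<Longrightarrow> s x = x"
    by (simp_all add: s_def)
  have ss: "s (s x) = x" for x by (simp add: s_def)
  \<comment> \<open>Positions are re-indexed by the involution \<open>s\<close>, so that
    \<open>A\<close> and \<open>B\<close> are the same condition on values of \<open>v\<close> over
    two ranges.\<close>
  define A where "A \<longleftrightarrow> (\<forall>r. s p < s r \<and> s r < s q \<longrightarrow> v r < v p \<or> v q < v r)"
  define B where "B \<longleftrightarrow> (\<forall>r. p < r \<and> r < q \<longrightarrow> v r < v p \<or> v q < v r)"
  have cA: "cov (tmul v i (Suc i)) (s p) (s q) \<longleftrightarrow> v p < v q \<and> A"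
    unfolding cov_def tmul_apply s_def[symmetric] A_def by (metis ss)
  have cB: "cov v p q \<longleftrightarrow> v p < v q \<and> B"
    unfolding cov_def B_def ..
  consider (a) "p = i" "Suc i < q" | (b) "p = Suc i" "Suc i < q" | (c) "p < i" "q = i"
    | (d) "p < i" "q = Suc i" | (e) "p \<noteq> i" "p \<noteq> Suc i" "q \<noteq> i" "q \<noteq> Suc i"
    using pq by fastforce
  then show ?thesis
  proof cases
    case a
    have F: "(p < r \<and> r < q) \<longleftrightarrow> r = Suc i \<or> (s p < s r \<and> s r < s q)" for r
      using a s by (cases "r = i"; cases "r = Suc i") auto
    have "B \<longleftrightarrow> (v (Suc i) < v i \<or> v q < v (Suc i)) \<and> A"
      unfolding A_def B_def F using a(1) by blast
    moreover have "tmul v p q i = v q" "tmul v p q (Suc i) = v (Suc i)"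
      using a by (simp_all add: tmul_apply)
    ultimately show ?thesis unfolding cA cB using a by auto
  next
    case b
    have F: "(s p < s r \<and> s r < s q) \<longleftrightarrow> r = i \<or> (p < r \<and> r < q)" for r
      using b s by (cases "r = i"; cases "r = Suc i") auto
    have "A \<longleftrightarrow> (v i < v (Suc i) \<or> v q < v i) \<and> B"
      unfolding A_def B_def F using b(1) by blast
    moreover have "tmul v p q i = v i" "tmul v p q (Suc i) = v q"
      using b by (simp_all add: tmul_apply)
    ultimately show ?thesis unfolding cA cB using b by auto
  next
    case c
    have F: "(s p < s r \<and> s r < s q) \<longleftrightarrow> r = Suc i \<or> (p < r \<and> r < q)" for r
      using c s by (cases "r = i"; cases "r = Suc i") auto
    have "A \<longleftrightarrow> (v (Suc i) < v p \<or> v i < v (Suc i)) \<and> B"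
      unfolding A_def B_def F using c(2) by blast
    moreover have "tmul v p q i = v p" "tmul v p q (Suc i) = v (Suc i)"
      using c by (simp_all add: tmul_apply)
    ultimately show ?thesis unfolding cA cB using c by auto
  next
    case d
    have F: "(p < r \<and> r < q) \<longleftrightarrow> r = i \<or> (s p < s r \<and> s r < s q)" for r
      using d s by (cases "r = i"; cases "r = Suc i") auto
    have "B \<longleftrightarrow> (v i < v p \<or> v (Suc i) < v i) \<and> A"
      unfolding A_def B_def F using d(2) by blast
    moreover have "tmul v p q i = v i" "tmul v p q (Suc i) = v p"
      using d by (simp_all add: tmul_apply)
    ultimately show ?thesis unfolding cA cB using d by auto
  next
    case e
    have "(s p < s r \<and> s r < s q) \<longleftrightarrow> (p < r \<and> r < q)" for r
      using e s pq by (cases "r = i"; cases "r = Suc i") auto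
    then have "A \<longleftrightarrow> B" by (simp only: A_def B_def)
    moreover have "tmul v p q i = v i" "tmul v p q (Suc i) = v (Suc i)"
      using e by (simp_all add: tmul_apply)
    ultimately show ?thesis unfolding cA cB by auto
  qed
qed

lemma act_u_act_d:
  fixes i :: nat
  defines "s \<equiv> Transposition.transpose i (Suc i)"
  assumes "1 \<le> i" "i < n" "1 \<le> p" "p < q" "q \<le> n" "(p, q) \<noteq> (i, Suc i)"
  shows "act_u n i (act_d n (s p) (s q) V) v = act_d n p q (act_u n i V) v"
proof (cases "v permutes {1..n}")
  case False
  then show ?thesis using assms by (simp add: act_u_def act_d_eq)
next
  case True
  have s: "1 \<le> s p" "s p < s q" "s q \<le> n"
    using assms by (auto simp: s_def Transposition.transpose_def)
  have "Transposition.transpose i (Suc i) \<circ> Transposition.transpose (s p) (s q)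
      = Transposition.transpose p q \<circ> Transposition.transpose i (Suc i)"
    using transpose_comp_eq[of "Transposition.transpose i (Suc i)" p q] by (simp add: s_def)
  then have "tmul (tmul v i (Suc i)) (s p) (s q) = tmul (tmul v p q) i (Suc i)"
    by (simp add: tmul_def comp_assoc)
  moreover have "v (Suc i) < v i \<and> cov (tmul v i (Suc i)) (s p) (s q) \<longleftrightarrow>
      cov v p q \<and> tmul v p q (Suc i) < tmul v p q i"
    unfolding s_def using assms(5,7) by (rule cov_tmul_adjacent[OF True])
  ultimately show ?thesis
    using assms(2-6) s True by (auto simp: act_u_def act_d_eq permutes_tmul)
qed

text \<open>One summand is \<open>V v\<close> and the other 0, according to whether \<open>v\<close>
  has a descent or an ascent at i.\<close>

lemma act_u_act_d_adjacent:
  assumes "1 \<le> i" "i < n" "v permutes {1..n}"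
  shows "act_u n i (act_d n i (Suc i) V) v + act_d n i (Suc i) (act_u n i V) v = V v"
  using assms permutes_eq_iff[OF assms(3), of i "Suc i"]
  by (auto simp: act_u_def act_d_eq cov_adjacent permutes_tmul tmul_apply)

lemma act_d_linear:
  "act_d n p q (\<lambda>v. c * V v + W v) v = c * act_d n p q V v + act_d n p q W v"
  by (simp add: act_d_def)

lemma act_d_0: "act_d n p q (\<lambda>v. 0) = (\<lambda>v. 0)"
  by (simp add: act_d_def)

lemma act_d_sum: "act_d n p q (\<lambda>v. \<Sum>a\<in>A. V a v) v = (\<Sum>a\<in>A. act_d n p q (V a) v)"
  by (cases "v permutes {1..n} \<and> inv_num n (tmul v p q) = inv_num n v + 1") (auto simp: act_d_def)

lemma act_u_linear:
  "act_u n i (\<lambda>v. c * V v + W v) v = c * act_u n i V v + act_u n i W v"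
  by (simp add: act_u_def)

lemma act_u_uminus: "act_u n i (\<lambda>v. - V v) v = - act_u n i V v"
  by (simp add: act_u_def)

lemma act_u_sum: "act_u n i (\<lambda>v. \<Sum>a\<in>A. V a v) v = (\<Sum>a\<in>A. act_u n i (V a) v)"
  by (cases "v permutes {1..n} \<and> v (Suc i) < v i") (auto simp: act_u_def)

text \<open>\<open>act_e n p j\<close> is antisymmetric in \<open>p, j\<close>; this makes the nil-Hecke relations uniform in \<open>j\<close>.\<close>

definition act_e :: "nat \<Rightarrow> nat \<Rightarrow> nat \<Rightarrow> galg \<Rightarrow> galg" where
  "act_e n p j V = (\<lambda>v. if p < j then act_d n p j V v else if j < p then - act_d n j p V v else 0)"

text \<open>This is y_j. The term p = j is 0; including it lets the sum be re-indexed by an adjacent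
  transposition.\<close>

definition dunkl :: "nat \<Rightarrow> nat \<Rightarrow> galg \<Rightarrow> galg" where
  "dunkl n j V = (\<lambda>v. \<Sum>p = 1..n. act_e n p j V v)"

text \<open>Conjugation by \<open>s\<close> reverses the order of p and j only if they are i and i +
  1; that case yields the correction. Outside the permutations the operators give 0, so the
  correction \<open>V v\<close> has to vanish there too.\<close>

lemma act_u_act_e:
  fixes i :: nat
  defines "s \<equiv> Transposition.transpose i (Suc i)"
  assumes i: "1 \<le> i" "i < n" and pj: "p \<in> {1..n}" "j \<in> {1..n}"
    and supp: "\<And>v. \<not> v permutes {1..n} \<Longrightarrow> V v = 0"
  shows "act_u n i (act_e n (s p) (s j) V) v = act_e n p j (act_u n i V) v +
    (if j = i then if p = Suc i then V v else 0 else if j = Suc i then if p = i then - V v else 0 else 0)"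
proof (cases "{p, j} = {i, Suc i}")
  case True
  have adj: "act_u n i (act_d n i (Suc i) V) v + act_d n i (Suc i) (act_u n i V) v = V v"
  proof (cases "v permutes {1..n}")
    case True
    then show ?thesis using act_u_act_d_adjacent i by blast
  next
    case False
    then show ?thesis using supp by (simp add: act_u_def act_d_def)
  qed
  have eq: "act_u n i (act_d n i (Suc i) V) v = V v - act_d n i (Suc i) (act_u n i V) v"
    using adj by (simp add: eq_diff_eq)
  from True consider "p = i" "j = Suc i" | "p = Suc i" "j = i" by (auto simp: doubleton_eq_iff)
  then show ?thesis
    by cases (simp_all add: act_e_def s_def act_u_uminus eq)
next
  case False
  then consider "p = j" | "p < j" "(p, j) \<noteq> (i, Suc i)" | "j < p" "(j, p) \<noteq> (i, Suc i)"
    by fastforce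
  then show ?thesis
  proof cases
    case 1
    then show ?thesis by (auto simp: act_e_def act_u_def)
  next
    case 2
    then have "s p < s j" by (auto simp: s_def Transposition.transpose_def)
    then show ?thesis
      using act_u_act_d[OF i, of p j V v] 2 False pj by (auto simp: act_e_def s_def)
  next
    case 3
    then have "s j < s p" by (auto simp: s_def Transposition.transpose_def)
    then show ?thesis
      using act_u_act_d[OF i, of j p V v] 3 False pj by (auto simp: act_e_def s_def act_u_uminus)
  qed
qed

text \<open>The nil-Hecke relation: re-indexing the sum by \<open>s\<close> conjugates every term,
  and for j = i or j = i + 1 exactly one term contributes a correction.\<close>

lemma act_u_dunkl:
  fixes i :: nat
  defines "s \<equiv> Transposition.transpose i (Suc i)"
  assumes i: "1 \<le> i" "i < n" and j: "j \<in> {1..n}"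
    and supp: "\<And>v. \<not> v permutes {1..n} \<Longrightarrow> V v = 0"
  shows "act_u n i (dunkl n (s j) V) v = dunkl n j (act_u n i V) v +
    (if j = i then V v else if j = Suc i then - V v else 0)"
proof -
  have s: "s permutes {1..n}" unfolding s_def using i by (intro permutes_swap_id) auto
  have "dunkl n (s j) V = (\<lambda>v. \<Sum>p = 1..n. act_e n (s p) (s j) V v)"
    unfolding dunkl_def by (rule ext) (subst sum.permute[OF s], simp)
  then have "act_u n i (dunkl n (s j) V) v = (\<Sum>p = 1..n. act_u n i (act_e n (s p) (s j) V) v)"
    by (simp add: act_u_sum)
  also have "\<dots> = (\<Sum>p = 1..n. act_e n p j (act_u n i V) v +
      (if j = i then if p = Suc i then V v else 0 else if j = Suc i then if p = i then - V v else 0 else 0))"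
    unfolding s_def using act_u_act_e[OF i _ j supp] by (intro sum.cong) auto
  also have "\<dots> = dunkl n j (act_u n i V) v +
      (\<Sum>p = 1..n. if j = i then if p = Suc i then V v else 0 else if j = Suc i then if p = i then - V v else 0 else 0)"
    by (simp add: sum.distrib dunkl_def)
  also have "(\<Sum>p = 1..n. if j = i then if p = Suc i then V v else 0 else if j = Suc i then if p = i then - V v else 0 else 0)
      = (if j = i then V v else if j = Suc i then - V v else 0)"
  proof (cases "j = i")
    case True
    then show ?thesis using i by simp
  next
    case False
    then show ?thesis using i by (cases "j = Suc i") simp_all
  qed
  finally show ?thesis .
qed

lemma act_e_linear:
  "act_e n p j (\<lambda>v. c * V v + W v) v = c * act_e n p j V v + act_e n p j W v"
  by (simp add: act_e_def act_d_linear)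

lemma dunkl_linear:
  "dunkl n j (\<lambda>v. c * V v + W v) v = c * dunkl n j V v + dunkl n j W v"
  by (simp add: dunkl_def act_e_linear sum.distrib sum_distrib_left)

lemma dunkl_outside: "\<not> v permutes {1..n} \<Longrightarrow> dunkl n j V v = 0"
  unfolding dunkl_def act_e_def act_d_def by (intro sum.neutral) simp

text \<open>Only coefficients at permutations are ever read, which allows an arbitrary
  \<open>V\<close> to be cut off outside them.\<close>

lemma dunkl_cong:
  assumes "j \<in> {1..n}" and "\<And>v. v permutes {1..n} \<Longrightarrow> V v = W v"
  shows "dunkl n j V = dunkl n j W"
proof
  fix v
  show "dunkl n j V v = dunkl n j W v"
    unfolding dunkl_def act_e_def
    using assms by (intro sum.cong) (auto simp: act_d_def permutes_tmul)
qed

section \<open>Descending induction from the longest permutation, and commutation of the Dunkl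
  elements\<close>

lemma inv_num_le: "inv_num n w \<le> n * n"
proof -
  have "invs n w \<subseteq> {1..n} \<times> {1..n}" by (auto simp: invs_def)
  then have "card (invs n w) \<le> card ({1..n} \<times> {1..n})" by (intro card_mono) auto
  then show ?thesis by (simp add: inv_num_eq_card_invs)
qed

lemma permutes_w0: "w0 n permutes {1..n}"
proof (rule bij_imp_permutes)
  show "bij_betw (w0 n) {1..n} {1..n}"
    by (rule bij_betw_byWitness[where f' = "w0 n"]) (auto simp: w0_def)
qed (auto simp: w0_def)

lemma eq_w0_if_no_ascent:
  assumes w: "w permutes {1..n}" and desc: "\<And>i. 1 \<le> i \<Longrightarrow> i < n \<Longrightarrow> w (Suc i) < w i"
  shows "w = w0 n"
proof
  fix k
  show "w k = w0 n k"
  proof (cases "k \<in> {1..n}")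
    case False
    then show ?thesis using permutes_not_in[OF w] by (auto simp: w0_def)
  next
    case True
    \<comment> \<open>A descent at every position makes \<open>w k + k\<close> weakly decreasing, from at most \<open>n + 1\<close> to at least \<open>n + 1\<close>.\<close>
    have mono: "w b + b \<le> w a + a" if "a \<le> b" "1 \<le> a" "b \<le> n" for a b
      using that
    proof (induction b rule: dec_induct)
      case (step b)
      then show ?case using desc[of b] by simp
    qed simp
    have "w x \<in> {1..n}" if "x \<in> {1..n}" for x using permutes_in_image[OF w] that by blast
    from this[of 1] this[of n] mono[of 1 k] mono[of k n] True show ?thesis
      by (auto simp: w0_def)
  qed
qed

text \<open>Induction down the weak order: a permutation other than \<open>w0 n\<close> has an
  ascent, and swapping there gives a longer one. The bound on the length makes this terminate. The
  Schubert recursion follows the same order.\<close>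

lemma permutes_descending_induct [consumes 1, case_names w0 step]:
  assumes "w permutes {1..n}" and "P (w0 n)"
    and step: "\<And>w i. w permutes {1..n} \<Longrightarrow> 1 \<le> i \<Longrightarrow> i < n \<Longrightarrow> w (Suc i) < w i \<Longrightarrow> P w \<Longrightarrow>
      P (tmul w i (Suc i))"
  shows "P w"
  using assms(1)
proof (induction "n * n - inv_num n w" arbitrary: w rule: less_induct)
  case less
  show ?case
  proof (cases "\<exists>i. 1 \<le> i \<and> i < n \<and> w i < w (Suc i)")
    case False
    then have "w = w0 n"
      using eq_w0_if_no_ascent[OF less.prems] permutes_eq_iff[OF less.prems]
      by (metis linorder_neqE_nat n_not_Suc_n)
    then show ?thesis using assms(2) by simp
  next
    case True
    then obtain i where i: "1 \<le> i" "i < n" "w i < w (Suc i)" by blast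
    let ?u = "tmul w i (Suc i)"
    have u: "?u permutes {1..n}" using less.prems i by (intro permutes_tmul) auto
    have "n * n - inv_num n ?u < n * n - inv_num n w"
      using inv_num_adjacent[OF i] inv_num_le[of n ?u] by simp
    then have "P ?u" using less.hyps u by blast
    then have "P (tmul ?u i (Suc i))"
      using i step[OF u, of i] by (simp add: tmul_apply)
    then show ?thesis by simp
  qed
qed

lemma act_d_w0:
  assumes "1 \<le> p" "p < q" "q \<le> n"
  shows "act_d n p q V (w0 n) = 0"
  using assms by (auto simp: act_d_eq cov_def w0_def)

lemma dunkl_w0: "j \<in> {1..n} \<Longrightarrow> dunkl n j V (w0 n) = 0"
  unfolding dunkl_def act_e_def by (intro sum.neutral) (auto simp: act_d_w0)

lemma act_u_dunkl_dunkl: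
  fixes i :: nat
  defines "s \<equiv> Transposition.transpose i (Suc i)"
  assumes i: "1 \<le> i" "i < n" and ab: "a \<in> {1..n}" "b \<in> {1..n}"
    and supp: "\<And>v. \<not> v permutes {1..n} \<Longrightarrow> V v = 0"
  shows "act_u n i (dunkl n (s a) (dunkl n (s b) V)) v =
    dunkl n a (dunkl n b (act_u n i V)) v +
    (if b = i then dunkl n a V v else if b = Suc i then - dunkl n a V v else 0) +
    (if a = i then dunkl n (s b) V v else if a = Suc i then - dunkl n (s b) V v else 0)"
proof -
  \<comment> \<open>The scalar correction from the inner passage of u_i, taken as a polynomial so
    that \<open>dunkl_linear\<close> applies.\<close>
  define c :: mpoly where "c = (if b = i then 1 else if b = Suc i then - 1 else 0)"
  have "act_u n i (dunkl n (s b) V) = (\<lambda>v. c * V v + dunkl n b (act_u n i V) v)"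
    unfolding s_def c_def using act_u_dunkl[OF i ab(2) supp] by (intro ext) auto
  then have "dunkl n a (act_u n i (dunkl n (s b) V)) v =
      c * dunkl n a V v + dunkl n a (dunkl n b (act_u n i V)) v"
    by (simp add: dunkl_linear)
  then show ?thesis
    using act_u_dunkl[OF i ab(1), of "dunkl n (s b) V" v] dunkl_outside by (auto simp: s_def c_def)
qed

text \<open>Conjugating by \<open>u\<^sub>i\<close> turns the commutator of \<open>y\<^sub>a, y\<^sub>b\<close> at \<open>w t\<^sub>i\<^sub>,\<^sub>i\<^sub>+\<^sub>1\<close> into one at the longer \<open>w\<close>;
  at \<open>w\<^sub>0\<close> everything vanishes.\<close>

lemma dunkl_commute_supp:
  assumes "v permutes {1..n}" "a \<in> {1..n}" "b \<in> {1..n}"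
    and "\<And>v. \<not> v permutes {1..n} \<Longrightarrow> V v = 0"
  shows "dunkl n a (dunkl n b V) v = dunkl n b (dunkl n a V) v"
  using assms
proof (induction v arbitrary: V a b rule: permutes_descending_induct)
  case w0
  then show ?case by (simp add: dunkl_w0)
next
  case (step w i)
  define s where "s = Transposition.transpose i (Suc i)"
  have s: "s permutes {1..n}" unfolding s_def using step.hyps by (intro permutes_swap_id) auto
  then have sab: "s a \<in> {1..n}" "s b \<in> {1..n}" using step.prems permutes_in_image[OF s] by blast+
  have ss: "s (s x) = x" for x by (simp add: s_def)
  have si: "s x = i \<longleftrightarrow> x = Suc i" "s x = Suc i \<longleftrightarrow> x = i" "x \<noteq> i \<Longrightarrow> x \<noteq> Suc i \<Longrightarrow> s x = x" "s i = Suc i" "s (Suc i) = i" for x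
    by (auto simp: s_def Transposition.transpose_def)
  have u: "act_u n i F w = F (tmul w i (Suc i))" for F
    using step.hyps by (simp add: act_u_def)
  have "dunkl n (s a) (dunkl n (s b) (act_u n i V)) w = dunkl n (s b) (dunkl n (s a) (act_u n i V)) w"
    using sab by (intro step.IH) (auto simp: act_u_def)
  moreover note act_u_dunkl_dunkl[OF step.hyps(2,3) sab, of V w, OF step.prems(3)]
    act_u_dunkl_dunkl[OF step.hyps(2,3) sab(2,1), of V w, OF step.prems(3)]
  \<comment> \<open>The corrections for the two orders agree: an index outside i, i + 1 is fixed by
    \<open>s\<close>, and if a and b are i and i + 1, the two corrections of each order
    cancel.\<close>
  ultimately show ?case
    unfolding s_def[symmetric] ss u si(1,2)
    by (cases "a = i"; cases "a = Suc i"; cases "b = i"; cases "b = Suc i") (auto simp: si)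
qed

lemma dunkl_commute:
  assumes "a \<in> {1..n}" "b \<in> {1..n}"
  shows "dunkl n a (dunkl n b V) = dunkl n b (dunkl n a V)"
proof
  fix v
  define W where "W = (\<lambda>v. if v permutes {1..n} then V v else 0)"
  have "dunkl n a V = dunkl n a W" "dunkl n b V = dunkl n b W"
    using assms by (auto intro!: dunkl_cong simp: W_def)
  then show "dunkl n a (dunkl n b V) v = dunkl n b (dunkl n a V) v"
    using dunkl_commute_supp[of v n a b W] assms
    by (cases "v permutes {1..n}") (auto simp: dunkl_outside W_def)
qed

section \<open>Rows as products of Dunkl factors\<close>

declare upt_Suc [simp del]

section \<open>Supports under the row factors\<close>

definition dec_supp :: "nat \<Rightarrow> nat \<Rightarrow> galg \<Rightarrow> bool" where
  "dec_supp n m V \<longleftrightarrow> (\<forall>v. V v \<noteq> 0 \<longrightarrow> v permutes {1..n} \<and>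
    (\<forall>a b. m \<le> a \<and> a < b \<and> b \<le> n \<longrightarrow> v b < v a))"

lemma dec_supp_mono: "dec_supp n m V \<Longrightarrow> m \<le> m' \<Longrightarrow> dec_supp n m' V"
  by (auto simp: dec_supp_def)

text \<open>From \<open>tmul v p j\<close> to \<open>v\<close> only the tail entry at j changes. It
  grows, and the cover condition keeps it from overtaking an earlier tail entry.\<close>

lemma dec_supp_act_d:
  assumes V: "dec_supp n m V" and pj: "1 \<le> p" "p < m" "m \<le> j" "j \<le> n"
  shows "dec_supp n m (act_d n p j V)"
  unfolding dec_supp_def
proof (intro allI impI)
  fix v assume "act_d n p j V v \<noteq> 0"
  then have v: "v permutes {1..n}" "cov v p j" "V (tmul v p j) \<noteq> 0"
    using pj by (auto simp: act_d_eq split: if_splits)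
  have val: "tmul v p j j = v p" "\<And>a. m \<le> a \<Longrightarrow> a \<noteq> j \<Longrightarrow> tmul v p j a = v a"
    using pj by (auto simp: tmul_apply)
  have "v b < v a" if ab: "m \<le> a" "a < b" "b \<le> n" for a b
  proof -
    have lt: "tmul v p j b < tmul v p j a" using V v(3) ab unfolding dec_supp_def by blast
    consider "a = j" | "b = j" | "a \<noteq> j" "b \<noteq> j" by blast
    then show ?thesis
    proof cases
      case 1
      then show ?thesis using lt val ab v(2) by (auto simp: cov_def)
    next
      case 2
      then have "v a < v p \<or> v j < v a" using v(2) ab pj by (auto simp: cov_def)
      then show ?thesis using lt val ab 2 by auto
    next
      case 3
      then show ?thesis using lt val ab by auto
    qed
  qed
  then show "v permutes {1..n} \<and> (\<forall>a b. m \<le> a \<and> a < b \<and> b \<le> n \<longrightarrow> v b < v a)"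
    using v(1) by blast
qed

text \<open>The variable is decoupled from the row index, because rows m and m - 1 will be compared
  in the same variable.\<close>

definition row_factor :: "nat \<Rightarrow> nat \<Rightarrow> mpoly \<Rightarrow> nat \<Rightarrow> galg \<Rightarrow> galg" where
  "row_factor n i x j V = (\<lambda>v. x * V v + (\<Sum>k = 1..i. act_d n k j V v))"

definition row :: "nat \<Rightarrow> nat \<Rightarrow> mpoly \<Rightarrow> galg \<Rightarrow> galg" where
  "row n i x = fold (row_factor n i x) [Suc i..<Suc n]"

lemma act_R_eq_row: "act_R n i = row n i (X i)"
proof -
  have "act_factor n i = row_factor n i (X i)"
    by (intro ext) (simp add: act_factor_def row_factor_def)
  then show ?thesis by (intro ext) (simp add: act_R_def row_def)
qed

lemma row_factor_neq_0:
  assumes "row_factor n i x j V v \<noteq> 0"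
  shows "V v \<noteq> 0 \<or> (\<exists>k\<in>{1..i}. act_d n k j V v \<noteq> 0)"
  using assms unfolding row_factor_def by (metis add_0 mult_zero_right sum.neutral)

lemma dec_supp_row_factor:
  assumes V: "dec_supp n m V" and "i < m" "m \<le> j" "j \<le> n"
  shows "dec_supp n m (row_factor n i x j V)"
proof -
  have d: "dec_supp n m (act_d n k j V)" if "k \<in> {1..i}" for k
    using dec_supp_act_d[OF V, of k j] that assms by auto
  show ?thesis unfolding dec_supp_def
    using row_factor_neq_0[of n i x j V] V d unfolding dec_supp_def by blast
qed

lemma dec_supp_row:
  assumes "dec_supp n (Suc i) V"
  shows "dec_supp n (Suc i) (row n i x V)"
proof -
  have "dec_supp n (Suc i) (fold (row_factor n i x) xs V)" if "set xs \<subseteq> {Suc i..n}" for xs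
    using that assms
    by (induction xs arbitrary: V) (auto intro!: dec_supp_row_factor)
  from this[of "[Suc i..<Suc n]"] show ?thesis by (simp add: row_def subset_eq)
qed

text \<open>The support condition kept while the factors for columns \<open>m + 1, \<dots>, N\<close> are applied to an
  element decreasing from position \<open>m\<close> on.\<close>

definition col_supp :: "nat \<Rightarrow> nat \<Rightarrow> nat \<Rightarrow> galg \<Rightarrow> bool" where
  "col_supp n m N V \<longleftrightarrow> dec_supp n (Suc m) V \<and> (\<forall>v q. V v \<noteq> 0 \<longrightarrow> N < q \<and> q \<le> n \<longrightarrow> v q < v m)"

text \<open>A swap with k = m brings to position m the former entry of column N + 1, which exceeds
  all later ones; a swap with k < m leaves positions m and q alone.\<close>

lemma col_supp_row_factor:
  assumes V: "col_supp n m N V" and m: "1 \<le> m" "m \<le> N" "N < n"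
  shows "col_supp n m (Suc N) (row_factor n m x (Suc N) V)"
  unfolding col_supp_def
proof (intro conjI allI impI)
  show "dec_supp n (Suc m) (row_factor n m x (Suc N) V)"
    using V m by (intro dec_supp_row_factor) (auto simp: col_supp_def)
next
  fix v q assume nz: "row_factor n m x (Suc N) V v \<noteq> 0" and q: "Suc N < q \<and> q \<le> n"
  have dec: "dec_supp n (Suc m) V" using V by (simp add: col_supp_def)
  from row_factor_neq_0[OF nz] show "v q < v m"
  proof
    assume "V v \<noteq> 0"
    then show ?thesis using V q by (auto simp: col_supp_def)
  next
    assume "\<exists>k\<in>{1..m}. act_d n k (Suc N) V v \<noteq> 0"
    then obtain k where k: "k \<in> {1..m}" "act_d n k (Suc N) V v \<noteq> 0" by blast
    then have c: "cov v k (Suc N)" "V (tmul v k (Suc N)) \<noteq> 0"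
      using m by (auto simp: act_d_eq split: if_splits)
    have vq: "tmul v k (Suc N) q = v q" using k q m by (auto simp: tmul_apply)
    show ?thesis
    proof (cases "k = m")
      case True
      have "tmul v k (Suc N) q < tmul v k (Suc N) (Suc N)"
        using dec c(2) q m unfolding dec_supp_def by (meson Suc_leI le_imp_less_Suc)
      then show ?thesis using vq True by (simp add: tmul_apply)
    next
      case False
      then have "tmul v k (Suc N) m = v m" using k m by (auto simp: tmul_apply)
      then show ?thesis using V c(2) q vq unfolding col_supp_def by (metis Suc_lessD)
    qed
  qed
qed

section \<open>Moving the factor x + y_m through a row\<close>

context
  fixes n m N :: nat and Y :: galg
  assumes Y: "col_supp n m N Y" and m: "1 \<le> m" "m \<le> N" "N < n"
begin

text \<open>A nonzero coefficient would give a permutation in the support of \<open>Y\<close> an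
  ascent from position q to N + 1, inside its decreasing tail.\<close>

lemma act_d_act_d_same_left:
  assumes "m < q" "q \<le> N"
  shows "act_d n m q (act_d n m (Suc N) Y) v = 0"
proof (rule ccontr)
  assume "\<not> ?thesis"
  then have c: "cov v m q" "Y (tmul (tmul v m q) m (Suc N)) \<noteq> 0"
    using m assms by (auto simp: act_d_eq split: if_splits)
  have "tmul (tmul v m q) m (Suc N) (Suc N) < tmul (tmul v m q) m (Suc N) q"
    using Y c(2) m assms unfolding col_supp_def dec_supp_def by (meson Suc_leI le_imp_less_Suc)
  then show False using c(1) m assms by (auto simp: tmul_apply cov_def)
qed

lemma act_d_act_d_same: "act_d n m (Suc N) (act_d n m (Suc N) V) v = 0"
  using m by (auto simp: act_d_eq cov_def tmul_apply)

text \<open>Here the ascent would go from position m to N + 1, which the second clause of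
  \<open>col_supp\<close> excludes.\<close>

lemma act_d_act_d_through_row:
  assumes "1 \<le> p" "p < m"
  shows "act_d n p m (act_d n p (Suc N) Y) v = 0"
proof (rule ccontr)
  assume "\<not> ?thesis"
  then have c: "cov v p m" "Y (tmul (tmul v p m) p (Suc N)) \<noteq> 0"
    using m assms by (auto simp: act_d_eq split: if_splits)
  have "tmul (tmul v p m) p (Suc N) (Suc N) < tmul (tmul v p m) p (Suc N) m"
    using Y c(2) m unfolding col_supp_def by (meson Suc_leI lessI)
  then show False using c(1) m assms by (auto simp: tmul_apply cov_def)
qed

text \<open>Truncating y_m to columns up to N, this moves x + y_m past column N + 1: on
  \<open>Y\<close>, the factor x + B_{m,N+1} followed by the longer truncation equals the shorter
  one followed by x + B_{m-1,N+1}. The linear terms in d_{m,N+1} cancel, and the quadratic ones are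
  matched by the relations.\<close>

lemma row_column_exchange:
  fixes x :: mpoly
  defines "Z \<equiv> row_factor n m x (Suc N) Y"
  defines "L \<equiv> (\<lambda>v. x * Y v + (\<Sum>p = 1..m - 1. act_d n p m Y v) - (\<Sum>q\<in>{m<..N}. act_d n m q Y v))"
  shows "x * Z v + (\<Sum>p = 1..m - 1. act_d n p m Z v) - (\<Sum>q\<in>{m<..Suc N}. act_d n m q Z v)
    = row_factor n (m - 1) x (Suc N) L v"
proof -
  let ?M = "Suc N"
  define P where "P = {1..m - 1}"
  define Q where "Q = {m<..N}"
  have Pm: "{1..m} = insert m P" "m \<notin> P" "finite P" using m by (auto simp: P_def)
  have QM: "{m<..Suc N} = insert ?M Q" "?M \<notin> Q" "finite Q" using m by (auto simp: Q_def)
  have Zeq: "Z = (\<lambda>v. x * Y v + (act_d n m ?M Y v + (\<Sum>p\<in>P. act_d n p ?M Y v)))"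
    unfolding Z_def row_factor_def Pm(1) using Pm by simp
  have dZ: "act_d n a b Z v = x * act_d n a b Y v +
      (act_d n a b (act_d n m ?M Y) v + (\<Sum>p\<in>P. act_d n a b (act_d n p ?M Y) v))" for a b
    unfolding Zeq act_d_linear
    by (subst act_d_linear[of _ _ _ 1, unfolded mult_1]) (simp only: act_d_sum)
  have Leq: "L = (\<lambda>v. x * Y v + ((- 1) * (\<Sum>q\<in>Q. act_d n m q Y v) + (\<Sum>p\<in>P. act_d n p m Y v)))"
    by (intro ext) (simp add: L_def P_def Q_def)
  have dL: "act_d n a b L v = x * act_d n a b Y v -
      (\<Sum>q\<in>Q. act_d n a b (act_d n m q Y) v) + (\<Sum>p\<in>P. act_d n a b (act_d n p m Y) v)" for a b
    unfolding Leq act_d_linear by (simp add: act_d_sum)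
  have P: "1 \<le> p" "p < m" if "p \<in> P" for p using that m by (auto simp: P_def)
  have Q: "m < q" "q \<le> N" if "q \<in> Q" for q using that by (auto simp: Q_def)
  have QP: "(\<Sum>q\<in>Q. \<Sum>p\<in>P. act_d n m q (act_d n p ?M Y) v) =
      (\<Sum>p\<in>P. \<Sum>q\<in>Q. act_d n p ?M (act_d n m q Y) v)"
  proof (subst sum.swap, intro sum.cong refl)
    fix p q assume "p \<in> P" "q \<in> Q"
    then show "act_d n m q (act_d n p ?M Y) v = act_d n p ?M (act_d n m q Y) v"
      using P[of p] Q[of q] m by (subst act_d_commute) auto
  qed
  \<comment> \<open>For fixed p, terms with p' different from p commute and the diagonal one on the
    left vanishes. The three-term relation supplies the diagonal term on the right and a remainder,
    which later cancels against the q = N + 1 part of the truncated y_m.\<close>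
  have PP: "(\<Sum>p\<in>P. act_d n p m (act_d n m ?M Y) v) + (\<Sum>p\<in>P. \<Sum>p'\<in>P. act_d n p m (act_d n p' ?M Y) v)
      = (\<Sum>p\<in>P. \<Sum>p'\<in>P. act_d n p ?M (act_d n p' m Y) v) + (\<Sum>p\<in>P. act_d n m ?M (act_d n p ?M Y) v)"
  proof -
    have "(\<Sum>p'\<in>P. act_d n p m (act_d n p' ?M Y) v) + act_d n p m (act_d n m ?M Y) v
      = (\<Sum>p'\<in>P. act_d n p' ?M (act_d n p m Y) v) + act_d n m ?M (act_d n p ?M Y) v" if p: "p \<in> P" for p
    proof -
      have "(\<Sum>p'\<in>P - {p}. act_d n p m (act_d n p' ?M Y) v) =
          (\<Sum>p'\<in>P - {p}. act_d n p' ?M (act_d n p m Y) v)"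
      proof (intro sum.cong refl)
        fix p' assume "p' \<in> P - {p}"
        then show "act_d n p m (act_d n p' ?M Y) v = act_d n p' ?M (act_d n p m Y) v"
          using P[of p] P[of p'] p m by (subst act_d_commute) auto
      qed
      moreover have "act_d n p m (act_d n p ?M Y) v = 0"
        using act_d_act_d_through_row P[OF p] by blast
      moreover have "act_d n p m (act_d n m ?M Y) v =
          act_d n p ?M (act_d n p m Y) v + act_d n m ?M (act_d n p ?M Y) v"
        using P[OF p] m by (intro act_d_triple) auto
      ultimately show ?thesis
        by (simp add: sum.remove[OF Pm(3) p])
    qed
    then have "(\<Sum>p\<in>P. (\<Sum>p'\<in>P. act_d n p m (act_d n p' ?M Y) v) + act_d n p m (act_d n m ?M Y) v)
      = (\<Sum>p\<in>P. (\<Sum>p'\<in>P. act_d n p' ?M (act_d n p m Y) v) + act_d n m ?M (act_d n p ?M Y) v)"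
      by (intro sum.cong) auto
    moreover have "(\<Sum>p\<in>P. \<Sum>p'\<in>P. act_d n p' ?M (act_d n p m Y) v) =
        (\<Sum>p\<in>P. \<Sum>p'\<in>P. act_d n p ?M (act_d n p' m Y) v)"
      by (rule sum.swap)
    ultimately show ?thesis by (simp add: sum.distrib add.commute)
  qed
  have Q0: "(\<Sum>q\<in>Q. act_d n m q (act_d n m ?M Y) v) = 0"
    using act_d_act_d_same_left Q by (intro sum.neutral) auto
  have l1: "(\<Sum>p\<in>P. act_d n p m Z v) = x * (\<Sum>p\<in>P. act_d n p m Y v) +
      ((\<Sum>p\<in>P. act_d n p m (act_d n m ?M Y) v) + (\<Sum>p\<in>P. \<Sum>p'\<in>P. act_d n p m (act_d n p' ?M Y) v))"
    by (simp add: dZ sum.distrib sum_distrib_left)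
  have l2: "(\<Sum>q\<in>{m<..Suc N}. act_d n m q Z v) = x * act_d n m ?M Y v +
      (\<Sum>p\<in>P. act_d n m ?M (act_d n p ?M Y) v) + x * (\<Sum>q\<in>Q. act_d n m q Y v) +
      (\<Sum>q\<in>Q. \<Sum>p\<in>P. act_d n m q (act_d n p ?M Y) v)"
    unfolding QM(1) using QM(2,3) by (simp add: dZ sum.distrib sum_distrib_left act_d_act_d_same Q0)
  have l3: "(\<Sum>p\<in>P. act_d n p ?M L v) = x * (\<Sum>p\<in>P. act_d n p ?M Y v) -
      (\<Sum>p\<in>P. \<Sum>q\<in>Q. act_d n p ?M (act_d n m q Y) v) + (\<Sum>p\<in>P. \<Sum>p'\<in>P. act_d n p ?M (act_d n p' m Y) v)"
    by (simp add: dL sum.distrib sum_subtractf sum_distrib_left)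
  show ?thesis
    unfolding row_factor_def P_def[symmetric] l1 l2 l3 PP QP
    by (simp add: Zeq Leq algebra_simps)
qed

end

section \<open>Replacing rows by products of Dunkl factors\<close>

definition dunkl_factor :: "nat \<Rightarrow> mpoly \<Rightarrow> nat \<Rightarrow> galg \<Rightarrow> galg" where
  "dunkl_factor n x j V = (\<lambda>v. x * V v + dunkl n j V v)"

definition dunkl_row :: "nat \<Rightarrow> nat \<Rightarrow> mpoly \<Rightarrow> galg \<Rightarrow> galg" where
  "dunkl_row n m x = fold (dunkl_factor n x) [Suc m..<Suc n]"

lemma dunkl_eq:
  assumes "j \<in> {1..n}"
  shows "dunkl n j V v = (\<Sum>p = 1..j - 1. act_d n p j V v) - (\<Sum>q\<in>{j<..n}. act_d n j q V v)"
proof -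
  have "{1..n} = {1..j - 1} \<union> insert j {j<..n}" "{1..j - 1} \<inter> insert j {j<..n} = {}"
    using assms by auto
  then have "dunkl n j V v = (\<Sum>p = 1..j - 1. act_e n p j V v) + (\<Sum>p\<in>insert j {j<..n}. act_e n p j V v)"
    unfolding dunkl_def by (simp add: sum.union_disjoint)
  moreover have "(\<Sum>p = 1..j - 1. act_e n p j V v) = (\<Sum>p = 1..j - 1. act_d n p j V v)"
    using assms by (intro sum.cong) (auto simp: act_e_def)
  moreover have "(\<Sum>p\<in>insert j {j<..n}. act_e n p j V v) = - (\<Sum>q\<in>{j<..n}. act_d n j q V v)"
    by (simp add: act_e_def sum_negf)
  ultimately show ?thesis by simp
qed

text \<open>Induction on the last column N treated. At N = m no factor of row m has acted, and the
  truncated x + y_m is the first factor of row m - 1; at N = n the truncation is complete.\<close>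

lemma dunkl_factor_row:
  assumes W: "dec_supp n m W" and m: "1 \<le> m" "m \<le> n"
  shows "dunkl_factor n x m (row n m x W) = row n (m - 1) x W"
proof -
  define R where "R N = fold (row_factor n m x) [Suc m..<Suc N] W" for N
  have R_Suc: "R (Suc N) = row_factor n m x (Suc N) (R N)" if "m \<le> N" for N
    using that by (simp add: R_def upt_Suc)
  have "col_supp n m N (R N) \<and>
      (\<lambda>v. x * R N v + (\<Sum>p = 1..m - 1. act_d n p m (R N) v) - (\<Sum>q\<in>{m<..N}. act_d n m q (R N) v))
      = fold (row_factor n (m - 1) x) [m..<Suc N] W" if "m \<le> N" "N \<le> n" for N
    using that
  proof (induction N rule: dec_induct)
    case base
    have "dec_supp n (Suc m) W" using dec_supp_mono[OF W] by simp
    then show ?case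
      using W by (auto simp: R_def col_supp_def dec_supp_def row_factor_def upt_Suc)
  next
    case (step N)
    then have IH: "col_supp n m N (R N)"
      "(\<lambda>v. x * R N v + (\<Sum>p = 1..m - 1. act_d n p m (R N) v) - (\<Sum>q\<in>{m<..N}. act_d n m q (R N) v))
      = fold (row_factor n (m - 1) x) [m..<Suc N] W" and N: "m \<le> N" "N < n" by auto
    show ?case
      using col_supp_row_factor[OF IH(1) m(1) N] row_column_exchange[OF IH(1) m(1) N, of x] N
      by (auto simp: R_Suc[OF N(1)] IH(2) upt_Suc)
  qed
  from this[of n] m have "(\<lambda>v. x * R n v + dunkl n m (R n) v) = fold (row_factor n (m - 1) x) [m..<Suc n] W"
    by (simp add: dunkl_eq algebra_simps)
  then show ?thesis using m by (simp add: dunkl_factor_def row_def R_def)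
qed

lemma dunkl_factor_commute:
  assumes "a \<in> {1..n}" "b \<in> {1..n}"
  shows "dunkl_factor n x a (dunkl_factor n y b V) = dunkl_factor n y b (dunkl_factor n x a V)"
  unfolding dunkl_factor_def dunkl_linear dunkl_commute[OF assms] by (simp add: algebra_simps)

lemma fold_dunkl_factor_commute:
  assumes "b \<in> {1..n}" "set js \<subseteq> {1..n}"
  shows "fold (dunkl_factor n x) js (dunkl_factor n y b V) = dunkl_factor n y b (fold (dunkl_factor n x) js V)"
  using assms(2) by (induction js arbitrary: V) (auto simp: dunkl_factor_commute[OF _ assms(1)])

lemma dunkl_row_dunkl_factor:
  assumes "b \<in> {1..n}"
  shows "dunkl_row n m x (dunkl_factor n y b V) = dunkl_factor n y b (dunkl_row n m x V)"
  unfolding dunkl_row_def using assms by (intro fold_dunkl_factor_commute) auto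

lemma dunkl_row_commute: "dunkl_row n m x (dunkl_row n k y V) = dunkl_row n k y (dunkl_row n m x V)"
proof -
  have "dunkl_row n m x (fold (dunkl_factor n y) js V) = fold (dunkl_factor n y) js (dunkl_row n m x V)" if "set js \<subseteq> {1..n}" for js
    using that by (induction js arbitrary: V) (auto simp: dunkl_row_dunkl_factor)
  from this[of "[Suc k..<Suc n]"] show ?thesis
    unfolding dunkl_row_def[of n k y] by (simp add: subset_eq)
qed

lemma dunkl_row_Suc: "i < n \<Longrightarrow> dunkl_row n i x V = dunkl_row n (Suc i) x (dunkl_factor n x (Suc i) V)"
  by (simp add: dunkl_row_def upt_conv_Cons[of "Suc i"])

text \<open>Descending induction from m = n, where both products are empty. Each step adds x +
  y_{k+1} on both sides, up to reordering commuting factors.\<close>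

lemma row_eq_dunkl_row:
  assumes "dec_supp n (Suc m) W" "m \<le> n"
  shows "row n m x W = dunkl_row n m x W"
  using assms(2,1)
proof (induction m rule: inc_induct)
  case base
  then show ?case by (simp add: row_def dunkl_row_def)
next
  case (step k)
  have "row n k x W = dunkl_factor n x (Suc k) (row n (Suc k) x W)"
    using dunkl_factor_row[OF step.prems] step.hyps by simp
  also have "row n (Suc k) x W = dunkl_row n (Suc k) x W"
    using step.IH dec_supp_mono[OF step.prems] by simp
  finally show ?case using step.hyps by (simp add: dunkl_row_Suc dunkl_row_dunkl_factor)
qed

text \<open>Evaluating at a permutation replaces the support hypothesis on \<open>V\<close>, which
  can be cut off without changing either side.\<close>

lemma act_u_dunkl_permutes:
  fixes i :: nat
  defines "s \<equiv> Transposition.transpose i (Suc i)"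
  assumes i: "1 \<le> i" "i < n" and j: "j \<in> {1..n}" and v: "v permutes {1..n}"
  shows "act_u n i (dunkl n (s j) V) v = dunkl n j (act_u n i V) v +
    (if j = i then V v else if j = Suc i then - V v else 0)"
proof -
  define W where "W = (\<lambda>v. if v permutes {1..n} then V v else 0)"
  have "s j \<in> {1..n}" unfolding s_def using i j by (auto simp: Transposition.transpose_def)
  then have "dunkl n (s j) V = dunkl n (s j) W" by (intro dunkl_cong) (auto simp: W_def)
  moreover have "act_u n i V = act_u n i W"
    using i by (intro ext) (simp add: act_u_def W_def permutes_tmul)
  moreover have "V v = W v" using v by (simp add: W_def)
  ultimately show ?thesis
    unfolding s_def using act_u_dunkl[OF i j, of W v] by (simp add: W_def)
qed

lemma act_u_dunkl_factor:
  assumes i: "1 \<le> i" "i < n" and j: "j \<in> {1..n}" "j \<noteq> i" "j \<noteq> Suc i"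
  shows "act_u n i (dunkl_factor n x j V) = dunkl_factor n x j (act_u n i V)"
proof
  fix v
  have "act_u n i (dunkl n j V) v = dunkl n j (act_u n i V) v"
  proof (cases "v permutes {1..n}")
    case True
    then show ?thesis using act_u_dunkl_permutes[OF i j(1), of v V] j by simp
  next
    case False
    then show ?thesis by (simp add: dunkl_outside) (simp add: act_u_def)
  qed
  then show "act_u n i (dunkl_factor n x j V) v = dunkl_factor n x j (act_u n i V) v"
    by (simp add: dunkl_factor_def act_u_linear)
qed

lemma act_u_dunkl_row:
  assumes i: "1 \<le> i" "i < n" and m: "Suc i \<le> m"
  shows "act_u n i (dunkl_row n m x V) = dunkl_row n m x (act_u n i V)"
proof -
  have "act_u n i (fold (dunkl_factor n x) js V) = fold (dunkl_factor n x) js (act_u n i V)" if "set js \<subseteq> {Suc m..n}" for js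
    using that by (induction js arbitrary: V) (use i m in \<open>auto simp: act_u_dunkl_factor\<close>)
  from this[of "[Suc m..<Suc n]"] show ?thesis
    unfolding dunkl_row_def by (simp add: subset_eq)
qed

lemma dunkl_0: "dunkl n j (\<lambda>v. 0) v = 0"
  unfolding dunkl_def act_e_def act_d_0 by (intro sum.neutral) simp

lemma dunkl_row_0: "dunkl_row n m x (\<lambda>v. 0) = (\<lambda>v. 0)"
proof -
  have "dunkl_factor n x j (\<lambda>v. 0) = (\<lambda>v. 0)" for j
    by (intro ext) (simp add: dunkl_factor_def dunkl_0)
  then have "fold (dunkl_factor n x) js (\<lambda>v. 0) = (\<lambda>v. 0)" for js
    by (induction js) simp_all
  then show ?thesis by (simp add: dunkl_row_def)
qed

definition swap_coeffs :: "nat \<Rightarrow> galg \<Rightarrow> galg" where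
  "swap_coeffs i V = (\<lambda>v. swap_poly i (V v))"

lemma swap_coeffs_act_d: "swap_poly i (act_d n p q V v) = act_d n p q (swap_coeffs i V) v"
  by (simp add: act_d_def swap_coeffs_def swap_poly_0)

lemma swap_coeffs_dunkl: "swap_poly i (dunkl n j V v) = dunkl n j (swap_coeffs i V) v"
  unfolding dunkl_def act_e_def swap_poly_sum
  by (intro sum.cong refl) (simp add: swap_poly_uminus swap_coeffs_act_d swap_poly_0)

lemma swap_coeffs_dunkl_factor: "swap_coeffs i (dunkl_factor n x j V) = dunkl_factor n (swap_poly i x) j (swap_coeffs i V)"
  by (intro ext, simp add: dunkl_factor_def swap_coeffs_def[of _ "\<lambda>v. x * V v + dunkl n j V v"] swap_poly_add
      swap_poly_mult swap_coeffs_dunkl) (simp add: swap_coeffs_def)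

lemma swap_coeffs_dunkl_row: "swap_coeffs i (dunkl_row n m x V) = dunkl_row n m (swap_poly i x) (swap_coeffs i V)"
proof -
  have "swap_coeffs i (fold (dunkl_factor n x) js V) = fold (dunkl_factor n (swap_poly i x)) js (swap_coeffs i V)" for js
    by (induction js arbitrary: V) (simp_all add: swap_coeffs_dunkl_factor)
  then show ?thesis by (simp add: dunkl_row_def)
qed

section \<open>The Schubert recursion\<close>

lemma S_BPD_prefix:
  assumes "1 \<le> k" "k \<le> n"
  shows "dec_supp n k (fold (act_R n) [1..<k] (basis (w0 n))) \<and>
    fold (act_R n) [1..<k] (basis (w0 n)) = fold (\<lambda>i. dunkl_row n i (X i)) [1..<k] (basis (w0 n))"
  using assms
proof (induction k rule: dec_induct)
  case base
  show ?case using permutes_w0 by (auto simp: dec_supp_def basis_def w0_def split: if_splits)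
next
  case (step k)
  let ?W = "fold (act_R n) [1..<k] (basis (w0 n))"
  have W: "dec_supp n (Suc k) ?W" "?W = fold (\<lambda>i. dunkl_row n i (X i)) [1..<k] (basis (w0 n))"
    using step by (auto intro: dec_supp_mono)
  \<comment> \<open>The support left by the first k - 1 rows licenses the change to Dunkl factors in
    row k.\<close>
  have "act_R n k ?W = dunkl_row n k (X k) ?W"
    unfolding act_R_eq_row using step.prems by (intro row_eq_dunkl_row W(1)[unfolded act_R_eq_row]) auto
  moreover have "dec_supp n (Suc k) (act_R n k ?W)"
    unfolding act_R_eq_row[of n k] by (rule dec_supp_row[OF W(1)])
  ultimately show ?case using W(2) step.hyps(1) by (simp add: upt_Suc)
qed

lemma S_BPD_divdiff:
  assumes i: "1 \<le> i" "i < n" and w: "w permutes {1..n}" "w (Suc i) < w i"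
  shows "S_BPD n (tmul w i (Suc i)) = divdiff i (S_BPD n w)"
proof -
  let ?T = "\<lambda>i. dunkl_row n i (X i)"
  define W where "W = fold ?T [1..<i] (basis (w0 n))"
  define rest where "rest = fold ?T [Suc (Suc i)..<Suc n]"
  \<comment> \<open>Row i without its factor at i + 1 runs over the same indices as row i + 1. These
    two rows commute, and no other row contains \<open>X i\<close> or \<open>X (Suc i)\<close>, so
    \<open>G\<close> is symmetric in them.\<close>
  define G where "G = rest (dunkl_row n (Suc i) (X (Suc i)) (dunkl_row n (Suc i) (X i) W))"
  have decW: "dec_supp n i W" using S_BPD_prefix[of i n] i by (auto simp: W_def)
  \<comment> \<open>Row n is empty; appending it lets row i + 1 be split off even for i = n -
    1.\<close>
  have Tn: "?T n V = V" for V by (simp add: dunkl_row_def)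
  have "S_BPD n = fold ?T [1..<n] (basis (w0 n))"
    using S_BPD_prefix[of n n] i by (simp add: S_BPD_def)
  also have "\<dots> = fold ?T [1..<Suc n] (basis (w0 n))"
    using i by (simp add: Tn upt_Suc)
  also have "[1..<Suc n] = [1..<i] @ i # Suc i # [Suc (Suc i)..<Suc n]"
    using upt_add_eq_append[of 1 i "Suc n - i"] i by (simp add: upt_conv_Cons)
  also have "fold ?T \<dots> (basis (w0 n)) = rest (?T (Suc i) (?T i W))"
    by (simp add: W_def rest_def)
  also have "\<dots> = rest (dunkl_row n (Suc i) (X (Suc i)) (dunkl_row n (Suc i) (X i) (dunkl_factor n (X i) (Suc i) W)))"
    using i by (simp add: dunkl_row_Suc)
  also have "\<dots> = dunkl_factor n (X i) (Suc i) G"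
  proof -
    have "fold ?T ks (dunkl_factor n y (Suc i) V) = dunkl_factor n y (Suc i) (fold ?T ks V)" for ks y V
      using i by (induction ks arbitrary: V) (simp_all add: dunkl_row_dunkl_factor)
    then show ?thesis using i by (simp add: G_def rest_def dunkl_row_dunkl_factor)
  qed
  finally have V: "S_BPD n = dunkl_factor n (X i) (Suc i) G" .
  have swap_fold: "swap_coeffs i (fold ?T ks V) = fold ?T ks (swap_coeffs i V)"
    if "i \<notin> set ks" "Suc i \<notin> set ks" for ks V
    using that by (induction ks arbitrary: V) (simp_all add: swap_coeffs_dunkl_row swap_poly_X)
  have "swap_coeffs i (basis (w0 n)) = basis (w0 n)"
    by (auto simp: swap_coeffs_def basis_def swap_poly_0 swap_poly_1)
  then have "swap_coeffs i W = W" by (simp add: W_def swap_fold)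
  then have swap_G: "swap_coeffs i G = G"
    unfolding G_def rest_def
    by (simp add: swap_fold swap_coeffs_dunkl_row swap_poly_X dunkl_row_commute[of n "Suc i" "X i"])
  \<comment> \<open>Every permutation in the support of \<open>W\<close> has a descent at i, whereas
    u_i reads only coefficients at ascents.\<close>
  have "act_u n i W = (\<lambda>v. 0)"
  proof
    fix v
    have "\<not> tmul v i (Suc i) (Suc i) < tmul v i (Suc i) i" if "v (Suc i) < v i"
      using that by (simp add: tmul_apply)
    then show "act_u n i W v = 0"
      using decW i unfolding dec_supp_def act_u_def by (metis Suc_leI lessI order_refl)
  qed
  moreover have "act_u n i (rest V) = rest (act_u n i V)" for V
  proof -
    have "act_u n i (fold ?T ks V) = fold ?T ks (act_u n i V)" if "set ks \<subseteq> {Suc i..n}" for ks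
      using that by (induction ks arbitrary: V) (use i in \<open>simp_all add: act_u_dunkl_row\<close>)
    from this[of "[Suc (Suc i)..<Suc n]"] show ?thesis
      unfolding rest_def by (simp add: subset_eq)
  qed
  moreover have "rest (\<lambda>v. 0) = (\<lambda>v. 0)"
  proof -
    have "fold ?T ks (\<lambda>v. 0) = (\<lambda>v. 0)" for ks
      by (induction ks) (simp_all add: dunkl_row_0)
    then show ?thesis by (simp add: rest_def)
  qed
  ultimately have uG: "act_u n i G = (\<lambda>v. 0)"
    unfolding G_def using i by (simp add: act_u_dunkl_row dunkl_row_0)
  have "S_BPD n (tmul w i (Suc i)) = act_u n i (S_BPD n) w"
    using w by (simp add: act_u_def)
  also have "\<dots> = act_u n i (dunkl n (Suc i) G) w"
    by (simp add: V dunkl_factor_def act_u_linear uG)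
  \<comment> \<open>The nil-Hecke relation at j = i, where s j = i + 1 and the correction is +
    \<open>G w\<close>.\<close>
  also have "\<dots> = dunkl n i (\<lambda>v. 0) w + G w"
    using act_u_dunkl_permutes[OF i, of i w G] i w uG by simp
  also have "\<dots> = G w" by (simp add: dunkl_0)
  finally have "S_BPD n (tmul w i (Suc i)) = G w" .
  moreover have "swap_poly i (S_BPD n w) = X (Suc i) * G w + dunkl n (Suc i) G w"
    using fun_cong[OF swap_coeffs_dunkl_factor[of i n "X i" "Suc i" G], of w]
    by (simp add: V swap_coeffs_def[of i "dunkl_factor n (X i) (Suc i) G"] swap_G swap_poly_X) (simp add: dunkl_factor_def)
  then have "(X i - X (Suc i)) * G w = S_BPD n w - swap_poly i (S_BPD n w)"
    by (simp add: V dunkl_factor_def algebra_simps)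
  ultimately show ?thesis using divdiff_eqI by metis
qed

text \<open>Nothing covers \<open>w0 n\<close>, so at this coefficient each of the n - i factors of
  row i merely multiplies by \<open>X i\<close>.\<close>

lemma S_BPD_w0: "S_BPD n (w0 n) = (\<Prod>k = 1..n - 1. X k ^ (n - k))"
proof -
  have factor: "row_factor n i x j V (w0 n) = x * V (w0 n)" if "i < j" "j \<le> n" for i j x V
    using that by (simp add: row_factor_def act_d_w0)
  have "fold (row_factor n i x) js V (w0 n) = x ^ length js * V (w0 n)" if "set js \<subseteq> {Suc i..n}" for i x js V
    using that by (induction js arbitrary: V) (auto simp: factor)
  from this[of "[Suc i..<Suc n]" i for i]
  have row: "act_R n i V (w0 n) = X i ^ (n - i) * V (w0 n)" for i V
    by (force simp: act_R_eq_row row_def)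
  have "fold (act_R n) [1..<Suc k] (basis (w0 n)) (w0 n) = (\<Prod>k = 1..k. X k ^ (n - k))" for k
    by (induction k) (simp_all add: basis_def row upt_Suc mult.commute)
  from this[of "n - 1"] show ?thesis
    by (cases n) (simp_all add: S_BPD_def basis_def)
qed

theorem theorem4p2:
  fixes n :: nat and S :: "(nat \<Rightarrow> nat) \<Rightarrow> mpoly"
  assumes "n \<ge> 1"
    and "S (w0 n) = (\<Prod>k = 1..n - 1. X k ^ (n - k))"
    and "\<And>w i. w permutes {1..n} \<Longrightarrow> 1 \<le> i \<Longrightarrow> i \<le> n - 1 \<Longrightarrow> w i > w (Suc i) \<Longrightarrow>
           S (tmul w i (Suc i)) = divdiff i (S w)"
  shows "S_BPD n = (\<lambda>w. if w permutes {1..n} then S w else 0)"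
proof
  fix w
  show "S_BPD n w = (if w permutes {1..n} then S w else 0)"
  proof (cases "w permutes {1..n}")
    case True
    then have "S_BPD n w = S w"
    proof (induction w rule: permutes_descending_induct)
      case w0
      then show ?case using S_BPD_w0 assms(2) by simp
    next
      case (step w i)
      then show ?case using S_BPD_divdiff[of i n w] assms(3)[of w i] by simp
    qed
    with True show ?thesis by simp
  next
    case False
    \<comment> \<open>From position n on the order condition is empty; what remains is that the
      support consists of permutations.\<close>
    have "dec_supp n n (S_BPD n)" unfolding S_BPD_def using S_BPD_prefix[of n n] assms(1) by blast
    then show ?thesis using False by (auto simp: dec_supp_def)
  qed
qed

end
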